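(* Let $F$ be a fullerene graph. Then its asymmetric depth satisfies $d(F)\in\{0,2,3,4\}$.
   Context: All graphs are finite, undirected and simple. A fullerene graph is a cubic, 3-connected, planar graph all of whose faces are pentagons or hexagons. A partial automorphism of a graph $F$ is an isomorphism between two induced subgraphs of $F$; its rank is the number of vertices in its domain, and it is nontrivial if it moves at least one vertex of its domain. The asymmetric depth of a graph $F$ of order $n\ge 2$ is $d(F)=n-k$, where $k$ is the largest positive integer such that $F$ admits a nontrivial partial automorphism of rank $k$. *)

theory Defs
  imports "HOL-Analysis.Analysis" "Graph_Theory.Digraph_Isomorphism"
begin

text \<open>
  Finite simple undirected graphs are the \<^locale>\<open>pair_graph\<close>s: finite loopless digraphs with a
  symmetric arc relation, in which an edge between \<open>u\<close> and \<open>v\<close> is the pair of arcs \<open>(u, v)\<close>,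
  \<open>(v, u)\<close>.
\<close>

definition cubic :: "'a pair_pre_digraph \<Rightarrow> bool" where
  "cubic F \<longleftrightarrow> (\<forall>v \<in> pverts F. out_degree (with_proj F) v = 3)"

definition k_connected :: "nat \<Rightarrow> 'a pair_pre_digraph \<Rightarrow> bool" where
  "k_connected k F \<longleftrightarrow> card (pverts F) > k \<and>
     (\<forall>X \<subseteq> pverts F. card X < k \<longrightarrow>
        Digraph_Component.connected (with_proj F \<restriction> (pverts F - X)))"

text \<open>
  Vertices are drawn as points of the plane and edges as simple arcs joining their ends. Two distinct
  edges meet only in common ends, and no vertex lies in the interior of an edge. The two arcs
  representing one edge are drawn as the same curve.
\<close>

definition plane_embedding ::
  "'a pair_pre_digraph \<Rightarrow> ('a \<Rightarrow> real ^ 2) \<Rightarrow> ('a \<times> 'a \<Rightarrow> real \<Rightarrow> real ^ 2) \<Rightarrow> bool" where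
  "plane_embedding F p \<gamma> \<longleftrightarrow>
     inj_on p (pverts F) \<and>
     (\<forall>(u, v) \<in> parcs F.
        arc (\<gamma> (u, v)) \<and> pathstart (\<gamma> (u, v)) = p u \<and> pathfinish (\<gamma> (u, v)) = p v \<and>
        path_image (\<gamma> (v, u)) = path_image (\<gamma> (u, v)) \<and>
        path_image (\<gamma> (u, v)) \<inter> p ` pverts F = {p u, p v}) \<and>
     (\<forall>(u, v) \<in> parcs F. \<forall>(x, y) \<in> parcs F. {u, v} \<noteq> {x, y} \<longrightarrow>
        path_image (\<gamma> (u, v)) \<inter> path_image (\<gamma> (x, y)) \<subseteq> p ` ({u, v} \<inter> {x, y}))"

definition faces ::
  "'a pair_pre_digraph \<Rightarrow> ('a \<Rightarrow> real ^ 2) \<Rightarrow> ('a \<times> 'a \<Rightarrow> real \<Rightarrow> real ^ 2) \<Rightarrow> (real ^ 2) set set" where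
  "faces F p \<gamma> = components (- (p ` pverts F \<union> (\<Union>e \<in> parcs F. path_image (\<gamma> e))))"

text \<open>
  The unbounded face is one of the \<^const>\<open>faces\<close>. A face is a \<open>k\<close>-gon if its boundary is the drawing
  of a cycle of length \<open>k\<close>; in a 2-connected plane graph every face is bounded by a cycle.
\<close>

definition face_gon ::
  "nat \<Rightarrow> 'a pair_pre_digraph \<Rightarrow> ('a \<times> 'a \<Rightarrow> real \<Rightarrow> real ^ 2) \<Rightarrow> (real ^ 2) set \<Rightarrow> bool" where
  "face_gon k F \<gamma> f \<longleftrightarrow>
     (\<exists>c. pre_digraph.cycle (with_proj F) c \<and> length c = k \<and>
          frontier f = (\<Union>e \<in> set c. path_image (\<gamma> e)))"

definition fullerene :: "'a pair_pre_digraph \<Rightarrow> bool" where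
  "fullerene F \<longleftrightarrow> pair_graph F \<and> cubic F \<and> k_connected 3 F \<and>
     (\<exists>p \<gamma>. plane_embedding F p \<gamma> \<and>
        (\<forall>f \<in> faces F p \<gamma>. face_gon 5 F \<gamma> f \<or> face_gon 6 F \<gamma> f))"

text \<open>
  The rank of a partial automorphism with domain \<open>A\<close> is \<open>card A\<close>. Only the values of \<open>iso_verts h\<close>
  on \<open>A\<close> matter: they determine \<open>iso_arcs h\<close> on the arcs inside \<open>A\<close>.
\<close>

definition partial_automorphism ::
  "'a pair_pre_digraph \<Rightarrow> 'a set \<Rightarrow> ('a, 'a \<times> 'a, 'a, 'a \<times> 'a) digraph_isomorphism \<Rightarrow> bool" where
  "partial_automorphism F A h \<longleftrightarrow> A \<subseteq> pverts F \<and>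
     pre_digraph.digraph_isomorphism (with_proj F \<restriction> A) h \<and>
     (\<exists>B \<subseteq> pverts F. app_iso h (with_proj F \<restriction> A) = with_proj F \<restriction> B)"

definition has_nontrivial_partial_automorphism :: "'a pair_pre_digraph \<Rightarrow> nat \<Rightarrow> bool" where
  "has_nontrivial_partial_automorphism F k \<longleftrightarrow>
     (\<exists>A h. partial_automorphism F A h \<and> card A = k \<and> (\<exists>v \<in> A. iso_verts h v \<noteq> v))"

text \<open>
  For a graph with at least two vertices the greatest such \<open>k\<close> exists, since mapping one vertex to
  another has rank 1, and it is at most the order of the graph, so the subtraction is not truncated.
\<close>

definition asymmetric_depth :: "'a pair_pre_digraph \<Rightarrow> nat" where
  "asymmetric_depth F = card (pverts F) -
     (GREATEST k. k > 0 \<and> has_nontrivial_partial_automorphism F k)"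

end

theory Submission
  imports Defs "HOL-Combinatorics.Transposition"
begin

text \<open>
  Both halves of the argument are local and count degrees in the cubic graph \<open>F\<close>, whose order is
  denoted by \<open>n\<close>.

  The depth is at most 4: for an edge \<open>uv\<close>, delete the at most \<open>2 + 2\<close> further neighbours of \<open>u\<close>
  and \<open>v\<close>. What remains contains \<open>uv\<close> as an isolated edge, and exchanging its two ends is a
  nontrivial automorphism of an induced subgraph with at least \<open>n - 4\<close> vertices
  (\<open>swap_adjacent_rank\<close>).

  The depth is never 1: an isomorphism from \<open>F - v\<close> onto \<open>F - w\<close> preserves degrees. In \<open>F - v\<close> the
  neighbours of \<open>v\<close> are exactly the vertices whose degree has dropped, and likewise for \<open>w\<close>; hence
  sending \<open>v\<close> to \<open>w\<close> extends the isomorphism to an automorphism of \<open>F\<close>, which has rank \<open>n\<close>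
  (\<open>rank_extends_to_order\<close>).
\<close>

definition induced_iso_on :: "'a pair_pre_digraph \<Rightarrow> 'a set \<Rightarrow> ('a \<Rightarrow> 'a) \<Rightarrow> bool" where
  "induced_iso_on F A f \<longleftrightarrow> A \<subseteq> pverts F \<and> inj_on f A \<and> f ` A \<subseteq> pverts F \<and>
     (\<forall>x\<in>A. \<forall>y\<in>A. (f x, f y) \<in> parcs F \<longleftrightarrow> (x, y) \<in> parcs F)"

text \<open>
  Arcs being pairs of vertices, the arc component of an isomorphism carries no information beyond
  the vertex map, so that partial automorphisms can be handled as functions on vertices.
\<close>

lemma has_nontrivial_partial_automorphism_iff:
  assumes "pair_graph F"
  shows "has_nontrivial_partial_automorphism F k \<longleftrightarrow>
    (\<exists>A f. induced_iso_on F A f \<and> card A = k \<and> (\<exists>v\<in>A. f v \<noteq> v))"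
proof
  assume "has_nontrivial_partial_automorphism F k"
  then obtain A h B where A: "A \<subseteq> pverts F" "card A = k" "\<exists>v\<in>A. iso_verts h v \<noteq> v"
    and h: "pre_digraph.digraph_isomorphism (with_proj F \<restriction> A) h"
    and B: "B \<subseteq> pverts F" "app_iso h (with_proj F \<restriction> A) = with_proj F \<restriction> B"
    unfolding has_nontrivial_partial_automorphism_def partial_automorphism_def by blast
  let ?f = "iso_verts h"
  have img: "?f ` A = B"
    using arg_cong[OF B(2), of verts] by simp
  have arcs: "iso_arcs h ` {e \<in> parcs F. fst e \<in> A \<and> snd e \<in> A}
      = {e \<in> parcs F. fst e \<in> B \<and> snd e \<in> B}"
    using arg_cong[OF B(2), of arcs] by simp
  have proj: "iso_tail h = fst" "iso_head h = snd"
    using arg_cong[OF B(2), of tail] arg_cong[OF B(2), of head] by simp_all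
  have inj: "inj_on ?f A"
    using h by (simp add: pre_digraph.digraph_isomorphism_def)
  have on_arcs: "iso_arcs h (x, y) = (?f x, ?f y)" if "(x, y) \<in> parcs F" "x \<in> A" "y \<in> A" for x y
    using h that by (auto simp: pre_digraph.digraph_isomorphism_def proj prod_eq_iff)
  have "(?f x, ?f y) \<in> parcs F \<longleftrightarrow> (x, y) \<in> parcs F" if xy: "x \<in> A" "y \<in> A" for x y
  proof
    assume "(x, y) \<in> parcs F"
    then have "iso_arcs h (x, y) \<in> {e \<in> parcs F. fst e \<in> B \<and> snd e \<in> B}"
      using xy by (subst arcs[symmetric]) auto
    then show "(?f x, ?f y) \<in> parcs F"
      using on_arcs[OF \<open>(x, y) \<in> parcs F\<close> xy] by simp
  next
    assume "(?f x, ?f y) \<in> parcs F"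
    then have "(?f x, ?f y) \<in> iso_arcs h ` {e \<in> parcs F. fst e \<in> A \<and> snd e \<in> A}"
      using xy img by (subst arcs) auto
    then obtain x' y' where "(x', y') \<in> parcs F" "x' \<in> A" "y' \<in> A"
      "(?f x, ?f y) = iso_arcs h (x', y')"
      by auto
    then show "(x, y) \<in> parcs F"
      using on_arcs[of x' y'] inj xy by (auto dest: inj_onD)
  qed
  then have "induced_iso_on F A ?f"
    using A inj img B(1) by (auto simp: induced_iso_on_def)
  then show "\<exists>A f. induced_iso_on F A f \<and> card A = k \<and> (\<exists>v\<in>A. f v \<noteq> v)"
    using A by blast
next
  assume "\<exists>A f. induced_iso_on F A f \<and> card A = k \<and> (\<exists>v\<in>A. f v \<noteq> v)"
  then obtain A f where f: "induced_iso_on F A f" and A: "card A = k" "\<exists>v\<in>A. f v \<noteq> v"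
    by blast
  define h where "h = \<lparr>iso_verts = f, iso_arcs = map_prod f f, iso_head = snd, iso_tail = fst\<rparr>"
  have "wf_digraph (with_proj F \<restriction> A)"
    by unfold_locales auto
  moreover have "inj_on (map_prod f f) {e \<in> parcs F. fst e \<in> A \<and> snd e \<in> A}"
    using f by (intro inj_onI) (auto simp: induced_iso_on_def dest: inj_onD)
  ultimately have "pre_digraph.digraph_isomorphism (with_proj F \<restriction> A) h"
    using f by (simp add: pre_digraph.digraph_isomorphism_def h_def induced_iso_on_def)
  moreover have "app_iso h (with_proj F \<restriction> A) = with_proj F \<restriction> (f ` A)"
    using f
    by (intro pre_digraph.equality) (auto simp: h_def induced_iso_on_def image_iff, fastforce)
  ultimately have "partial_automorphism F A h"
    using f unfolding partial_automorphism_def induced_iso_on_def by blast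
  moreover have "\<exists>v\<in>A. iso_verts h v \<noteq> v"
    using A by (simp add: h_def)
  ultimately show "has_nontrivial_partial_automorphism F k"
    using A unfolding has_nontrivial_partial_automorphism_def by blast
qed

lemma out_degree_with_proj: "out_degree (with_proj F) v = card (parcs F `` {v})"
proof -
  have "out_arcs (with_proj F) v = Pair v ` (parcs F `` {v})"
    by auto
  then show ?thesis
    by (simp add: out_degree_def card_image inj_on_def)
qed

text \<open>
  Deleting all neighbours of \<open>u\<close> and \<open>v\<close> other than \<open>u\<close> and \<open>v\<close> isolates the edge \<open>uv\<close>, so that
  the transposition of its ends respects adjacency. At \<open>u\<close> and at \<open>v\<close> one neighbour survives,
  which accounts for the two subtractions of 1.
\<close>

lemma swap_adjacent_rank:
  assumes F: "pair_graph F" and uv: "(u, v) \<in> parcs F"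
  shows "\<exists>k \<ge> card (pverts F) - ((out_degree F u - 1) + (out_degree F v - 1)).
    k > 0 \<and> has_nontrivial_partial_automorphism F k"
proof -
  interpret pair_graph F by fact
  have sym: "(y, x) \<in> parcs F" if "(x, y) \<in> parcs F" for x y
    using pair_sym_arcs that by (auto simp: symmetric_def sym_def)
  have fin: "finite (pverts F)" by (rule pair_finite_verts)
  have nbrs: "parcs F `` {x} \<subseteq> pverts F" for x
    using in_arcsD2 by auto
  have finN: "finite (parcs F `` {x})" for x
    using nbrs fin by (rule finite_subset)
  have neq: "u \<noteq> v" and loop: "(x, x) \<notin> parcs F" for x
    using pair_no_loops uv by fastforce+
  define D where "D = (parcs F `` {u} - {v}) \<union> (parcs F `` {v} - {u})"
  define A where "A = pverts F - D"
  have "card D \<le> card (parcs F `` {u} - {v}) + card (parcs F `` {v} - {u})"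
    unfolding D_def by (rule card_Un_le)
  also have "\<dots> = (out_degree F u - 1) + (out_degree F v - 1)"
    using uv sym[OF uv] finN by (simp add: out_degree_with_proj)
  finally have cardD: "card D \<le> (out_degree F u - 1) + (out_degree F v - 1)" .
  have "D \<subseteq> pverts F"
    using nbrs by (auto simp: D_def)
  then have cardA: "card A = card (pverts F) - card D"
    unfolding A_def by (intro card_Diff_subset finite_subset[OF _ fin])
  have uA: "u \<in> A" and vA: "v \<in> A"
    using uv in_arcsD1 in_arcsD2 loop by (auto simp: A_def D_def)
  then have "card A > 0"
    using fin by (auto simp: A_def card_gt_0_iff)
  let ?f = "Transposition.transpose u v"
  have isolated_u: "(x, u) \<notin> parcs F \<and> (u, x) \<notin> parcs F" if "x \<in> A" "x \<noteq> v" for x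
    using that sym[of x u] by (auto simp: A_def D_def)
  have isolated_v: "(x, v) \<notin> parcs F \<and> (v, x) \<notin> parcs F" if "x \<in> A" "x \<noteq> u" for x
    using that sym[of x v] by (auto simp: A_def D_def)
  have "(?f x, ?f y) \<in> parcs F \<longleftrightarrow> (x, y) \<in> parcs F" if "x \<in> A" "y \<in> A" for x y
    using that uv sym[OF uv] loop uA vA neq isolated_u isolated_v
    by (cases "x = u"; cases "x = v"; cases "y = u"; cases "y = v") simp_all
  moreover have "?f ` A = A"
    using uA vA by (intro transpose_image_eq) auto
  ultimately have "induced_iso_on F A ?f"
    unfolding induced_iso_on_def by (auto simp: A_def)
  then have "has_nontrivial_partial_automorphism F (card A)"
    unfolding has_nontrivial_partial_automorphism_iff[OF F] using uA neq
    by (intro exI[of _ A] exI[of _ ?f]) (auto intro!: bexI[of _ u])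
  then show ?thesis
    using cardA cardD \<open>card A > 0\<close> by (intro exI[of _ "card A"]) auto
qed

text \<open>
  In a regular graph the neighbourhood of a deleted vertex can be read off from the degrees in the
  remaining graph, so an isomorphism between two vertex-deleted subgraphs carries the neighbourhood
  of one deleted vertex to that of the other.
\<close>

lemma rank_extends_to_order:
  assumes F: "pair_graph F" and reg: "\<forall>v\<in>pverts F. out_degree F v = d"
    and k: "has_nontrivial_partial_automorphism F k" "Suc k = card (pverts F)"
  shows "has_nontrivial_partial_automorphism F (card (pverts F))"
proof -
  interpret pair_graph F by fact
  let ?V = "pverts F" and ?N = "\<lambda>x. parcs F `` {x}"
  have sym: "(y, x) \<in> parcs F \<longleftrightarrow> (x, y) \<in> parcs F" for x y
    using pair_sym_arcs by (auto simp: symmetric_def sym_def)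
  have fin: "finite ?V" by (rule pair_finite_verts)
  have nbrs: "?N x \<subseteq> ?V" for x
    using in_arcsD2 by auto
  have finN: "finite (?N x)" for x
    using nbrs fin by (rule finite_subset)
  have loop: "(x, x) \<notin> parcs F" for x
    using pair_no_loops by fastforce
  obtain A f where f: "induced_iso_on F A f" and A: "card A = k" and nontriv: "\<exists>v\<in>A. f v \<noteq> v"
    using k(1) has_nontrivial_partial_automorphism_iff[OF F] by blast
  have AV: "A \<subseteq> ?V" "f ` A \<subseteq> ?V" and inj: "inj_on f A"
    using f by (auto simp: induced_iso_on_def)
  have arcs: "(f x, f y) \<in> parcs F \<longleftrightarrow> (x, y) \<in> parcs F" if "x \<in> A" "y \<in> A" for x y
    using f that by (auto simp: induced_iso_on_def)
  have missing_one: "\<exists>v. v \<notin> S \<and> insert v S = ?V" if "S \<subseteq> ?V" "card S = k" for S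
  proof -
    have "card (?V - S) = 1"
      using that fin k(2) by (subst card_Diff_subset) (auto intro: finite_subset)
    then obtain v where "?V - S = {v}"
      by (auto simp: card_1_singleton_iff)
    then show ?thesis
      using that by blast
  qed
  obtain v where v: "v \<notin> A" "insert v A = ?V"
    using missing_one[of A] AV A by blast
  obtain w where w: "w \<notin> f ` A" "insert w (f ` A) = ?V"
    using missing_one[of "f ` A"] AV A inj by (auto simp: card_image)
  have card_split: "card (?N x) = card (?N x \<inter> S) + (if (x, z) \<in> parcs F then 1 else 0)"
    if "z \<notin> S" "insert z S = ?V" for x z S
  proof (cases "(x, z) \<in> parcs F")
    case True
    then have "?N x = insert z (?N x \<inter> S)"
      using that nbrs[of x] by auto
    then have "card (?N x) = card (insert z (?N x \<inter> S))"
      by (rule arg_cong)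
    then show ?thesis
      using True that(1) finN[of x] by simp
  next
    case False
    then have "?N x \<inter> S = ?N x"
      using that nbrs[of x] by auto
    then show ?thesis
      using False by simp
  qed
  \<comment> \<open>Inside \<open>A\<close> and \<open>f ` A\<close> corresponding vertices have equally many neighbours, so by regularity
    they miss equally many, and the only vertices that can be missed are \<open>v\<close> and \<open>w\<close>.\<close>
  have to_w: "(f x, w) \<in> parcs F \<longleftrightarrow> (x, v) \<in> parcs F" if x: "x \<in> A" for x
  proof -
    have "?N (f x) \<inter> f ` A = f ` (?N x \<inter> A)"
      using arcs x by auto
    then have "card (?N (f x) \<inter> f ` A) = card (?N x \<inter> A)"
      using inj by (simp add: card_image inj_on_subset)
    moreover have "card (?N (f x)) = card (?N x)"
      using reg x AV by (simp add: out_degree_with_proj subset_iff image_subset_iff)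
    ultimately show ?thesis
      using card_split[OF v, of x] card_split[OF w, of "f x"] by (auto split: if_splits)
  qed
  let ?g = "f(v := w)"
  have "?g ` insert v A = insert w (f ` A)"
    using v(1) by auto
  then have "?g ` ?V = ?V"
    unfolding v(2) w(2) .
  moreover have "inj_on ?g (insert v A)"
    using inj v(1) w(1) by (auto simp: inj_on_def)
  then have "inj_on ?g ?V"
    unfolding v(2) .
  moreover have "(?g x, ?g y) \<in> parcs F \<longleftrightarrow> (x, y) \<in> parcs F"
    if "x \<in> insert v A" "y \<in> insert v A" for x y
    using that arcs to_w sym[of w] sym[of v] loop v(1) by auto
  then have "\<forall>x\<in>?V. \<forall>y\<in>?V. (?g x, ?g y) \<in> parcs F \<longleftrightarrow> (x, y) \<in> parcs F"
    unfolding v(2) by blast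
  ultimately have "induced_iso_on F ?V ?g"
    by (simp add: induced_iso_on_def)
  moreover have "\<exists>x\<in>?V. ?g x \<noteq> x"
    using nontriv v(1) AV(1) by (metis fun_upd_other subsetD)
  ultimately show ?thesis
    unfolding has_nontrivial_partial_automorphism_iff[OF F] by blast
qed

lemma has_nontrivial_partial_automorphism_le_order:
  assumes "pair_graph F" "has_nontrivial_partial_automorphism F k"
  shows "k \<le> card (pverts F)"
proof -
  interpret pair_graph F by fact
  show ?thesis
    using assms pair_finite_verts
    by (auto simp: has_nontrivial_partial_automorphism_def partial_automorphism_def
        intro: card_mono)
qed

theorem theorem4:
  fixes F :: "'a pair_pre_digraph"
  assumes "fullerene F"
  shows "asymmetric_depth F \<in> {0, 2, 3, 4}"
proof -
  have F: "pair_graph F" and cubic: "\<forall>v\<in>pverts F. out_degree F v = 3"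
    and "card (pverts F) > 3"
    using assms by (auto simp: fullerene_def cubic_def k_connected_def)
  interpret pair_graph F by (rule F)
  let ?n = "card (pverts F)"
  let ?P = "\<lambda>k. k > 0 \<and> has_nontrivial_partial_automorphism F k"
  define m where "m = (GREATEST k. ?P k)"
  have bound: "k \<le> ?n" if "?P k" for k
    using that has_nontrivial_partial_automorphism_le_order[OF F] by blast
  obtain u where u: "u \<in> pverts F"
    using \<open>?n > 3\<close> by fastforce
  then have "parcs F `` {u} \<noteq> {}"
    using cubic by (force simp: out_degree_with_proj)
  then obtain v where uv: "(u, v) \<in> parcs F"
    by auto
  then obtain k where k: "?P k" "?n - 4 \<le> k"
    using swap_adjacent_rank[OF F uv] cubic u in_arcsD2[OF uv] by auto
  have m: "?P m"
    unfolding m_def using k(1) bound by (rule GreatestI_nat)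
  have max: "j \<le> m" if "?P j" for j
    unfolding m_def using that bound by (rule Greatest_le_nat)
  have "?n - 4 \<le> m" "m \<le> ?n"
    using k max[OF k(1)] bound[OF m] by auto
  moreover have "Suc m \<noteq> ?n"
  proof
    assume "Suc m = ?n"
    then have "?P ?n"
      using rank_extends_to_order[OF F cubic] m by auto
    then show False
      using max[of ?n] \<open>Suc m = ?n\<close> by simp
  qed
  moreover have "asymmetric_depth F = ?n - m"
    by (simp add: asymmetric_depth_def m_def)
  ultimately show ?thesis
    by auto
qed

end
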